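(* Let $n\ge 3$ and let $\Gamma_f=(V,E,f)$ be a weighted cycle with vertices $s_1,s_2,\dots,s_n$ and directed edges $(s_1,s_2),(s_2,s_3),\dots,(s_{n-1},s_n),(s_n,s_1)$ (all edges unlabeled, i.e. $\Gamma$ is the Coxeter graph of the affine Coxeter group $\tilde A_{n-1}$). Suppose the product of the weights of the edges $$f((s_1,s_2))\,f((s_2,s_3))\cdots f((s_{n-1},s_n))\,f((s_n,s_1))$$ is equal to $a$, where $a\in\mathbb{C}\setminus\{0\}$ is an element of infinite multiplicative order. Then the representation $\mathcal{R}_{\Gamma,f}$ is faithful, i.e., the matrix group generated by the matrices $\mathcal{R}_{\Gamma,f}(s_i)=\omega_i$ ($1\le i\le n$) is isomorphic to the affine Coxeter group $\tilde A_{n-1}$.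
   Context: The affine Coxeter group $\tilde A_{n-1}$ ($n\ge 3$) is the group generated by $s_1,\dots,s_n$ with defining relations $s_i^2=1$, $(s_is_j)^3=1$ if $i-j\equiv\pm1\pmod n$, and $(s_is_j)^2=1$ for all other $i\ne j$. Its Coxeter graph $\Gamma=(V,E)$ is the cycle with vertices $s_1,\dots,s_n$ and edges $\{s_i,s_{i+1}\}$ (indices mod $n$). Let $\bar E$ be the set of directed edges: $\{s_i,s_j\}\in E$ if and only if $(s_i,s_j)\in\bar E$ and $(s_j,s_i)\in\bar E$. A weighted Coxeter graph $\Gamma_f=(V,E,f)$ is the graph together with a legal weight function, i.e. a function $f:\bar E\to\mathbb{C}\setminus\{0\}$ with $f((s_i,s_j))=f((s_j,s_i))^{-1}$. Representation $\mathcal{R}_{\Gamma,f}$: the generator $s_i$ is sent to the $n\times n$ complex matrix $\omega_i$ that differs from the identity matrix only in its $i$-th row; this row has $-1$ in position $(i,i)$, has $f((s_i,s_j))\cdot 2\cos(\pi/3)=f((s_i,s_j))$ in position $(i,j)$ when $s_i$ and $s_j$ are joined by an edge, and $0$ in position $(i,j)$ when $i\neq j$ and $s_i,s_j$ are not joined. The assignment $s_i\mapsto\omega_i$ extends to a group homomorphism $\mathcal{R}_{\Gamma,f}$ from $\tilde A_{n-1}$ to $GL_n(\mathbb{C})$. Faithful means that this homomorphism is injective. *)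

theory Defs
  imports "HOL-Algebra.Elementary_Groups" "Jordan_Normal_Form.Matrix"
begin

section \<open>Groups given by generators and relators\<close>

text \<open>A letter \<open>(True, s)\<close> stands for the generator \<open>s\<close>, and \<open>(False, s)\<close> for its formal inverse.\<close>

type_synonym 'a word = "(bool \<times> 'a) list"

definition words :: "'a set \<Rightarrow> 'a word set" where
  "words S = lists (UNIV \<times> S)"

lemma words_simps [simp]:
  "[] \<in> words S"
  "l # w \<in> words S \<longleftrightarrow> snd l \<in> S \<and> w \<in> words S"
  "v @ w \<in> words S \<longleftrightarrow> v \<in> words S \<and> w \<in> words S"
  by (auto simp: words_def in_lists_conv_set mem_Times_iff)

lemma words_inverse [simp]: "w \<in> words S \<Longrightarrow> rev (map (\<lambda>(b, s). (\<not> b, s)) w) \<in> words S"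
  by (induction w) auto

text \<open>The classes of the following relation are the elements of the free group on \<open>S\<close> modulo the
  normal closure of \<open>R\<close>.\<close>

inductive pres_eq :: "'a set \<Rightarrow> 'a word set \<Rightarrow> 'a word \<Rightarrow> 'a word \<Rightarrow> bool"
  for S :: "'a set" and R :: "'a word set" where
  refl: "w \<in> words S \<Longrightarrow> pres_eq S R w w"
| sym: "pres_eq S R v w \<Longrightarrow> pres_eq S R w v"
| trans: "pres_eq S R u v \<Longrightarrow> pres_eq S R v w \<Longrightarrow> pres_eq S R u w"
| cancel: "u \<in> words S \<Longrightarrow> v \<in> words S \<Longrightarrow> s \<in> S \<Longrightarrow>
    pres_eq S R (u @ [(b, s), (\<not> b, s)] @ v) (u @ v)"
| relator: "u \<in> words S \<Longrightarrow> v \<in> words S \<Longrightarrow> r \<in> R \<Longrightarrow> r \<in> words S \<Longrightarrow>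
    pres_eq S R (u @ r @ v) (u @ v)"

definition pres_rel :: "'a set \<Rightarrow> 'a word set \<Rightarrow> 'a word rel" where
  "pres_rel S R = {(v, w). pres_eq S R v w}"

definition presented_group :: "'a set \<Rightarrow> 'a word set \<Rightarrow> 'a word set monoid" where
  "presented_group S R =
    \<lparr>carrier = words S // pres_rel S R,
     monoid.mult = (\<lambda>X Y. \<Union>x\<in>X. \<Union>y\<in>Y. pres_rel S R `` {x @ y}),
     one = pres_rel S R `` {[]}\<rparr>"

definition presented_gen :: "'a set \<Rightarrow> 'a word set \<Rightarrow> 'a \<Rightarrow> 'a word set" where
  "presented_gen S R s = pres_rel S R `` {[(True, s)]}"

definition letter_eval :: "('g, 'm) monoid_scheme \<Rightarrow> ('a \<Rightarrow> 'g) \<Rightarrow> bool \<times> 'a \<Rightarrow> 'g" where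
  "letter_eval G \<phi> = (\<lambda>(b, s). if b then \<phi> s else inv\<^bsub>G\<^esub> \<phi> s)"

definition word_eval :: "('g, 'm) monoid_scheme \<Rightarrow> ('a \<Rightarrow> 'g) \<Rightarrow> 'a word \<Rightarrow> 'g" where
  "word_eval G \<phi> w = foldr (\<lambda>l x. letter_eval G \<phi> l \<otimes>\<^bsub>G\<^esub> x) w \<one>\<^bsub>G\<^esub>"

text \<open>The homomorphism on a presented group that extends the assignment \<open>\<phi>\<close> of the generators.
  It is meaningful only if \<open>\<phi>\<close> respects the relators, see \<open>presented_lift_hom\<close> below.\<close>

definition presented_lift :: "('g, 'm) monoid_scheme \<Rightarrow> ('a \<Rightarrow> 'g) \<Rightarrow> 'a word set \<Rightarrow> 'g" where
  "presented_lift G \<phi> X = the_elem (word_eval G \<phi> ` X)"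

lemma pres_eq_words: "pres_eq S R v w \<Longrightarrow> v \<in> words S \<and> w \<in> words S"
  by (induction rule: pres_eq.induct) auto

lemma equiv_pres_rel: "equiv (words S) (pres_rel S R)"
proof (rule equivI)
  show "pres_rel S R \<subseteq> words S \<times> words S"
    unfolding pres_rel_def using pres_eq_words by fastforce
  show "refl_on (words S) (pres_rel S R)"
    by (rule refl_onI) (auto simp: pres_rel_def intro: pres_eq.refl)
  show "sym (pres_rel S R)"
    by (rule symI) (auto simp: pres_rel_def intro: pres_eq.sym)
  show "trans (pres_rel S R)"
    by (rule transI) (auto simp: pres_rel_def intro: pres_eq.trans)
qed

lemma pres_eq_append_left:
  assumes "pres_eq S R v w" "x \<in> words S"
  shows "pres_eq S R (x @ v) (x @ w)"
  using assms
proof (induction rule: pres_eq.induct)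
  case (cancel u v s b)
  then show ?case using pres_eq.cancel[of "x @ u" S v s R b] by simp
next
  case (relator u v r)
  then show ?case using pres_eq.relator[of "x @ u" S v r R] by simp
qed (auto intro: pres_eq.intros)

lemma pres_eq_append_right:
  assumes "pres_eq S R v w" "x \<in> words S"
  shows "pres_eq S R (v @ x) (w @ x)"
  using assms
proof (induction rule: pres_eq.induct)
  case (cancel u v s b)
  then show ?case using pres_eq.cancel[of u S "v @ x" s R b] by simp
next
  case (relator u v r)
  then show ?case using pres_eq.relator[of u S "v @ x" r R] by simp
qed (auto intro: pres_eq.intros)

lemma pres_eq_append:
  assumes "pres_eq S R v w" "pres_eq S R v' w'"
  shows "pres_eq S R (v @ v') (w @ w')"
  using assms pres_eq_append_left pres_eq_append_right pres_eq_words pres_eq.trans by metis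

lemma pres_class_eq_iff:
  "v \<in> words S \<Longrightarrow> w \<in> words S \<Longrightarrow>
    pres_rel S R `` {v} = pres_rel S R `` {w} \<longleftrightarrow> pres_eq S R v w"
  using eq_equiv_class_iff[OF equiv_pres_rel, of v S w R] by (simp add: pres_rel_def)

lemma carrier_presented_group:
  "carrier (presented_group S R) = (\<lambda>w. pres_rel S R `` {w}) ` words S"
  by (auto simp: presented_group_def quotient_def)

lemma one_presented_group: "\<one>\<^bsub>presented_group S R\<^esub> = pres_rel S R `` {[]}"
  by (simp add: presented_group_def)

lemma mult_presented_group:
  assumes "v \<in> words S" "w \<in> words S"
  shows "pres_rel S R `` {v} \<otimes>\<^bsub>presented_group S R\<^esub> pres_rel S R `` {w} = pres_rel S R `` {v @ w}"
proof -
  have "congruent2 (pres_rel S R) (pres_rel S R) (\<lambda>x y. pres_rel S R `` {x @ y})"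
  proof (rule congruent2I')
    fix y1 z1 y2 z2
    assume "(y1, z1) \<in> pres_rel S R" "(y2, z2) \<in> pres_rel S R"
    then have "pres_eq S R (y1 @ y2) (z1 @ z2)"
      by (simp add: pres_rel_def pres_eq_append)
    then show "pres_rel S R `` {y1 @ y2} = pres_rel S R `` {z1 @ z2}"
      using pres_class_eq_iff pres_eq_words by metis
  qed
  from UN_equiv_class2[OF equiv_pres_rel equiv_pres_rel this assms]
  show ?thesis by (simp add: presented_group_def)
qed

lemma pres_eq_inverse:
  assumes "w \<in> words S"
  shows "pres_eq S R (rev (map (\<lambda>(b, s). (\<not> b, s)) w) @ w) []"
  using assms
proof (induction w)
  case Nil
  then show ?case by (simp add: pres_eq.refl)
next
  case (Cons l w)
  obtain b s where l: "l = (b, s)" by (cases l)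
  let ?i = "rev (map (\<lambda>(b, s). (\<not> b, s)) w)"
  have "?i \<in> words S" using Cons.prems by simp
  then have "pres_eq S R (?i @ [(\<not> b, s), (\<not> \<not> b, s)] @ w) (?i @ w)"
    using Cons.prems l by (intro pres_eq.cancel) auto
  then show ?case using Cons l by (auto intro: pres_eq.trans)
qed

lemma group_presented_group: "group (presented_group S R)"
proof (rule groupI)
  fix x
  assume "x \<in> carrier (presented_group S R)"
  then obtain w where w: "w \<in> words S" "x = pres_rel S R `` {w}"
    by (auto simp: carrier_presented_group)
  let ?i = "rev (map (\<lambda>(b, s). (\<not> b, s)) w)"
  have i: "?i \<in> words S" using w by simp
  have "pres_rel S R `` {?i @ w} = pres_rel S R `` {[]}"
    using pres_eq_inverse[OF w(1), of R] i w(1) by (subst pres_class_eq_iff) auto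
  then have "pres_rel S R `` {?i} \<otimes>\<^bsub>presented_group S R\<^esub> x = \<one>\<^bsub>presented_group S R\<^esub>"
    using w i by (simp add: mult_presented_group one_presented_group)
  then show "\<exists>y\<in>carrier (presented_group S R).
      y \<otimes>\<^bsub>presented_group S R\<^esub> x = \<one>\<^bsub>presented_group S R\<^esub>"
    using i by (auto simp: carrier_presented_group)
qed (auto simp: carrier_presented_group mult_presented_group one_presented_group)

context group
begin

lemma letter_eval_closed:
  "\<phi> \<in> S \<rightarrow> carrier G \<Longrightarrow> snd l \<in> S \<Longrightarrow> letter_eval G \<phi> l \<in> carrier G"
  by (cases l) (auto simp: letter_eval_def Pi_iff)

lemma word_eval_closed:
  "\<phi> \<in> S \<rightarrow> carrier G \<Longrightarrow> w \<in> words S \<Longrightarrow> word_eval G \<phi> w \<in> carrier G"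
  by (induction w) (auto simp: word_eval_def letter_eval_closed)

lemma word_eval_append:
  assumes "\<phi> \<in> S \<rightarrow> carrier G" "v \<in> words S" "w \<in> words S"
  shows "word_eval G \<phi> (v @ w) = word_eval G \<phi> v \<otimes> word_eval G \<phi> w"
  using assms(2)
proof (induction v)
  case Nil
  then show ?case using word_eval_closed[OF assms(1,3)] by (simp add: word_eval_def)
next
  case (Cons l v)
  have "letter_eval G \<phi> l \<in> carrier G" "word_eval G \<phi> v \<in> carrier G" "word_eval G \<phi> w \<in> carrier G"
    using Cons.prems assms letter_eval_closed[of \<phi> S] word_eval_closed[of \<phi> S] by auto
  then show ?case using Cons by (simp add: word_eval_def m_assoc)
qed

lemma word_eval_pres_eq:
  assumes \<phi>: "\<phi> \<in> S \<rightarrow> carrier G"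
    and R: "\<And>r. r \<in> R \<Longrightarrow> r \<in> words S \<Longrightarrow> word_eval G \<phi> r = \<one>"
    and "pres_eq S R v w"
  shows "word_eval G \<phi> v = word_eval G \<phi> w"
  using assms(3)
proof (induction rule: pres_eq.induct)
  case (cancel u v s b)
  have "\<phi> s \<in> carrier G" using \<phi> cancel by auto
  then have "word_eval G \<phi> [(b, s), (\<not> b, s)] = \<one>"
    by (auto simp: word_eval_def letter_eval_def)
  then show ?case
    using cancel word_eval_append[OF \<phi>] word_eval_closed[OF \<phi>] by (simp del: append.simps)
next
  case (relator u v r)
  then show ?case
    using R[of r] word_eval_append[OF \<phi>] word_eval_closed[OF \<phi>] by simp
qed auto

lemma presented_lift_class:
  assumes \<phi>: "\<phi> \<in> S \<rightarrow> carrier G"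
    and R: "\<And>r. r \<in> R \<Longrightarrow> r \<in> words S \<Longrightarrow> word_eval G \<phi> r = \<one>"
    and w: "w \<in> words S"
  shows "presented_lift G \<phi> (pres_rel S R `` {w}) = word_eval G \<phi> w"
proof -
  have "w \<in> pres_rel S R `` {w}" using w by (auto simp: pres_rel_def intro: pres_eq.refl)
  moreover have "\<And>v. v \<in> pres_rel S R `` {w} \<Longrightarrow> word_eval G \<phi> v = word_eval G \<phi> w"
    using word_eval_pres_eq[OF \<phi>, of R w] R by (simp add: pres_rel_def)
  ultimately have "word_eval G \<phi> ` (pres_rel S R `` {w}) = {word_eval G \<phi> w}" by blast
  then show ?thesis by (simp add: presented_lift_def)
qed

lemma presented_lift_hom:
  assumes \<phi>: "\<phi> \<in> S \<rightarrow> carrier G"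
    and R: "\<And>r. r \<in> R \<Longrightarrow> r \<in> words S \<Longrightarrow> word_eval G \<phi> r = \<one>"
  shows "presented_lift G \<phi> \<in> hom (presented_group S R) G"
  using presented_lift_class[OF \<phi>, of R] R word_eval_append[OF \<phi>] word_eval_closed[OF \<phi>]
  by (auto simp: hom_def carrier_presented_group mult_presented_group)

lemma presented_lift_gen:
  assumes \<phi>: "\<phi> \<in> S \<rightarrow> carrier G"
    and R: "\<And>r. r \<in> R \<Longrightarrow> r \<in> words S \<Longrightarrow> word_eval G \<phi> r = \<one>"
    and s: "s \<in> S"
  shows "presented_lift G \<phi> (presented_gen S R s) = \<phi> s"
proof -
  have "\<phi> s \<in> carrier G" using \<phi> s by auto
  then show ?thesis
    unfolding presented_gen_def using presented_lift_class[OF \<phi>, of R "[(True, s)]"] R s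
    by (simp add: word_eval_def letter_eval_def)
qed

end

section \<open>The affine Coxeter group and its weighted representations\<close>

text \<open>Indices are shifted by one: \<open>s\<^sub>1, \<dots>, s\<^sub>n\<close> are represented by \<open>0, \<dots>, n - 1\<close>, in accordance
  with the indexing of matrix entries.\<close>

definition cycle_darts :: "nat \<Rightarrow> (nat \<times> nat) set" where
  "cycle_darts n = {(i, j). i < n \<and> j < n \<and> (j = (i + 1) mod n \<or> i = (j + 1) mod n)}"

definition legal_weight :: "('v \<times> 'v) set \<Rightarrow> ('v \<times> 'v \<Rightarrow> complex) \<Rightarrow> bool" where
  "legal_weight D f \<longleftrightarrow> (\<forall>(u, v) \<in> D. f (u, v) \<noteq> 0 \<and> f (u, v) = inverse (f (v, u)))"

definition affine_A_relators :: "nat \<Rightarrow> nat word set" where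
  "affine_A_relators n =
    {[(True, i), (True, i)] | i. i < n}
    \<union> {concat (replicate 3 [(True, i), (True, j)]) | i j. (i, j) \<in> cycle_darts n}
    \<union> {concat (replicate 2 [(True, i), (True, j)]) | i j.
        i < n \<and> j < n \<and> i \<noteq> j \<and> (i, j) \<notin> cycle_darts n}"

text \<open>The group of type \<open>A\<close> tilde of rank \<open>n\<close>, that is, with subscript \<open>n - 1\<close>.\<close>

definition affine_A :: "nat \<Rightarrow> nat word set monoid" where
  "affine_A n = presented_group {..<n} (affine_A_relators n)"

definition affine_A_gen :: "nat \<Rightarrow> nat \<Rightarrow> nat word set" where
  "affine_A_gen n = presented_gen {..<n} (affine_A_relators n)"

definition GL :: "nat \<Rightarrow> complex mat monoid" where
  "GL n = units_of (ring_mat TYPE(complex) n ())"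

text \<open>The entry \<open>f (i, c)\<close> is \<open>f (i, c) * 2 * cos (pi / 3)\<close>, all edges of the cycle being unlabeled.\<close>

definition omega :: "nat \<Rightarrow> (nat \<times> nat \<Rightarrow> complex) \<Rightarrow> nat \<Rightarrow> complex mat" where
  "omega n f i = mat n n (\<lambda>(r, c).
     if r \<noteq> i then (if r = c then 1 else 0)
     else if c = i then - 1
     else if (i, c) \<in> cycle_darts n then f (i, c)
     else 0)"

definition weighted_rep :: "nat \<Rightarrow> (nat \<times> nat \<Rightarrow> complex) \<Rightarrow> nat word set \<Rightarrow> complex mat" where
  "weighted_rep n f = presented_lift (GL n) (omega n f)"

lemma group_GL: "group (GL n)"
proof -
  interpret ring "ring_mat TYPE(complex) n ()" by (rule ring_mat)
  show ?thesis unfolding GL_def by (rule units_group)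
qed

lemma GL_simps:
  "carrier (GL n) = {A \<in> carrier_mat n n. \<exists>B \<in> carrier_mat n n. B * A = 1\<^sub>m n \<and> A * B = 1\<^sub>m n}"
  "monoid.mult (GL n) = (*)" "one (GL n) = 1\<^sub>m n"
  by (auto simp: GL_def units_of_def Units_def ring_mat_def)

lemma omega_carrier_mat [simp]:
  "omega n f i \<in> carrier_mat n n" "dim_row (omega n f i) = n" "dim_col (omega n f i) = n"
  by (simp_all add: omega_def)

lemma omega_mult_other:
  assumes M: "M \<in> carrier_mat n n" and "r < n" "c < n" "r \<noteq> i"
  shows "(omega n f i * M) $$ (r, c) = M $$ (r, c)"
proof -
  have "(omega n f i * M) $$ (r, c) = (\<Sum>k<n. (if k = r then 1 else 0) * M $$ (k, c))"
    using assms by (auto simp: omega_def scalar_prod_def lessThan_atLeast0 intro!: sum.cong)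
  also have "\<dots> = M $$ (r, c)" using assms by (simp add: if_distrib[of "\<lambda>x. x * _"] cong: if_cong)
  finally show ?thesis .
qed

lemma omega_mult_row:
  assumes M: "M \<in> carrier_mat n n" and "i < n" "c < n"
  shows "(omega n f i * M) $$ (i, c) = - M $$ (i, c) +
    (\<Sum>k\<in>{..<n} - {i}. if (i, k) \<in> cycle_darts n then f (i, k) * M $$ (k, c) else 0)"
proof -
  have "(omega n f i * M) $$ (i, c) =
      (\<Sum>k<n. (if k = i then - 1 else if (i, k) \<in> cycle_darts n then f (i, k) else 0) * M $$ (k, c))"
    using assms by (auto simp: omega_def scalar_prod_def lessThan_atLeast0 intro!: sum.cong)
  also have "\<dots> = - M $$ (i, c) +
    (\<Sum>k\<in>{..<n} - {i}. if (i, k) \<in> cycle_darts n then f (i, k) * M $$ (k, c) else 0)"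
    using assms
    by (subst sum.remove[of _ i]) (auto simp: if_distrib[of "\<lambda>x. x * _"] intro!: sum.cong)
  finally show ?thesis .
qed

text \<open>Left multiplication by \<open>omega n f i\<close> only changes row \<open>i\<close>, and sends it to minus itself plus a
  combination of the neighbouring rows; below, the part contributed by row \<open>j\<close> is separated.\<close>

definition omega_rest ::
    "nat \<Rightarrow> (nat \<times> nat \<Rightarrow> complex) \<Rightarrow> nat \<Rightarrow> nat \<Rightarrow> complex mat \<Rightarrow> nat \<Rightarrow> complex" where
  "omega_rest n f i j M c =
    (\<Sum>k\<in>{..<n} - {i, j}. if (i, k) \<in> cycle_darts n then f (i, k) * M $$ (k, c) else 0)"

lemma omega_mult_row2:
  assumes "M \<in> carrier_mat n n" "i < n" "j < n" "i \<noteq> j" "c < n"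
  shows "(omega n f i * M) $$ (i, c) =
    - M $$ (i, c) + (if (i, j) \<in> cycle_darts n then f (i, j) else 0) * M $$ (j, c)
    + omega_rest n f i j M c"
proof -
  have "{..<n} - {i} - {j} = {..<n} - {i, j}" by auto
  then show ?thesis
    using assms by (subst omega_mult_row) (auto simp: omega_rest_def sum.remove[of "{..<n} - {i}" j])
qed

lemma omega_rest_cong:
  assumes "M \<in> carrier_mat n n" "c < n" "l = i \<or> l = j"
  shows "omega_rest n f i j (omega n f l * M) c = omega_rest n f i j M c"
  unfolding omega_rest_def
  by (rule sum.cong) (use assms in \<open>auto simp: omega_mult_other simp del: index_mult_mat(1)\<close>)

lemma omega_square:
  assumes M: "M \<in> carrier_mat n n" and i: "i < n"
  shows "omega n f i * (omega n f i * M) = M"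
proof (rule eq_matI)
  fix r c assume rc: "r < dim_row M" "c < dim_col M"
  have W: "omega n f i * M \<in> carrier_mat n n" using M omega_carrier_mat(1) by (rule mult_carrier_mat[rotated])
  show "(omega n f i * (omega n f i * M)) $$ (r, c) = M $$ (r, c)"
  proof (cases "r = i")
    case True
    have "(\<Sum>k\<in>{..<n} - {i}. if (i, k) \<in> cycle_darts n then f (i, k) * (omega n f i * M) $$ (k, c) else 0)
        = (\<Sum>k\<in>{..<n} - {i}. if (i, k) \<in> cycle_darts n then f (i, k) * M $$ (k, c) else 0)"
      by (rule sum.cong) (use M rc in \<open>auto simp: omega_mult_other simp del: index_mult_mat(1)\<close>)
    then show ?thesis using True M W i rc by (simp add: omega_mult_row del: index_mult_mat)
  next
    case False
    then show ?thesis using M W i rc by (simp add: omega_mult_other del: index_mult_mat)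
  qed
qed (use M in auto)

lemma omega_commute:
  assumes M: "M \<in> carrier_mat n n"
    and ij: "i < n" "j < n" "i \<noteq> j" "(i, j) \<notin> cycle_darts n"
  shows "omega n f i * (omega n f j * (omega n f i * (omega n f j * M))) = M"
proof -
  have ji: "(j, i) \<notin> cycle_darts n" using ij by (auto simp: cycle_darts_def)
  have C: "omega n f l * N \<in> carrier_mat n n" if "N \<in> carrier_mat n n" for l N
    using that omega_carrier_mat(1) by (rule mult_carrier_mat[rotated])
  show ?thesis
  proof (rule eq_matI)
    fix r c assume "r < dim_row M" "c < dim_col M"
    then have rc: "r < n" "c < n" using M by auto
    have comm: "omega_rest n f i j (omega n f l * N) c = omega_rest n f i j N c"
      "omega_rest n f j i (omega n f l * N) c = omega_rest n f j i N c"
      if "N \<in> carrier_mat n n" "l = i \<or> l = j" for l N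
      using that rc omega_rest_cong[of N n c l i j f] omega_rest_cong[of N n c l j i f] by auto
    consider "r = i" | "r = j" | "r \<noteq> i" "r \<noteq> j" by auto
    then show "(omega n f i * (omega n f j * (omega n f i * (omega n f j * M)))) $$ (r, c) = M $$ (r, c)"
      by cases (use M ij ji rc in \<open>simp_all add: C comm omega_mult_other omega_mult_row2[of _ n i j]
        omega_mult_row2[of _ n j i] del: index_mult_mat\<close>)
  qed (use M in auto)
qed

lemma omega_braid:
  assumes n: "n \<ge> 3" and f: "legal_weight (cycle_darts n) f"
    and M: "M \<in> carrier_mat n n" and ij: "(i, j) \<in> cycle_darts n"
  shows "omega n f i * (omega n f j * (omega n f i * (omega n f j * (omega n f i * (omega n f j * M))))) = M"
proof -
  have ji: "(j, i) \<in> cycle_darts n" and l: "i < n" "j < n"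
    using ij by (auto simp: cycle_darts_def)
  have "(k + 1) mod n \<noteq> k" if "k < n" for k
    using that n by (cases "k + 1 = n") auto
  then have ne: "i \<noteq> j" using ij unfolding cycle_darts_def by (metis (mono_tags, lifting) case_prodD mem_Collect_eq)
  have w: "f (i, j) * f (j, i) = 1" "f (j, i) * f (i, j) = 1"
    using f ij ji by (auto simp: legal_weight_def)
  then have w': "f (i, j) * (f (j, i) * x) = x" "f (j, i) * (f (i, j) * x) = x" for x
    by (simp_all flip: mult.assoc)
  have C: "omega n f l * N \<in> carrier_mat n n" if "N \<in> carrier_mat n n" for l N
    using that omega_carrier_mat(1) by (rule mult_carrier_mat[rotated])
  show ?thesis
  proof (rule eq_matI)
    fix r c assume "r < dim_row M" "c < dim_col M"
    then have rc: "r < n" "c < n" using M by auto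
    have comm: "omega_rest n f i j (omega n f l * N) c = omega_rest n f i j N c"
      "omega_rest n f j i (omega n f l * N) c = omega_rest n f j i N c"
      if "N \<in> carrier_mat n n" "l = i \<or> l = j" for l N
      using that rc omega_rest_cong[of N n c l i j f] omega_rest_cong[of N n c l j i f] by auto
    consider "r = i" | "r = j" | "r \<noteq> i" "r \<noteq> j" by auto
    then show "(omega n f i * (omega n f j * (omega n f i * (omega n f j *
        (omega n f i * (omega n f j * M)))))) $$ (r, c) = M $$ (r, c)"
      by cases (use M ij ji l ne rc in \<open>simp_all add: C comm omega_mult_other
        omega_mult_row2[of _ n i j] omega_mult_row2[of _ n j i] w w' algebra_simps del: index_mult_mat\<close>)
  qed (use M in auto)
qed

lemma omega_GL:
  assumes "i < n"
  shows "omega n f i \<in> carrier (GL n)"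
proof -
  have "omega n f i * omega n f i = 1\<^sub>m n"
    using omega_square[of "1\<^sub>m n" n i f] assms by (simp add: right_mult_one_mat[of _ n n])
  then show ?thesis by (auto simp: GL_simps)
qed

lemma omega_relators:
  assumes "n \<ge> 3" "legal_weight (cycle_darts n) f" "r \<in> affine_A_relators n"
  shows "word_eval (GL n) (omega n f) r = \<one>\<^bsub>GL n\<^esub>"
  using assms omega_square[of "1\<^sub>m n" n _ f] omega_commute[of "1\<^sub>m n" n _ _ f]
    omega_braid[of n f "1\<^sub>m n"]
  by (auto simp: affine_A_relators_def word_eval_def letter_eval_def GL_simps numeral_eq_Suc
      simp del: right_mult_one_mat)

lemma weighted_rep_hom:
  assumes "n \<ge> 3" "legal_weight (cycle_darts n) f"
  shows "weighted_rep n f \<in> hom (affine_A n) (GL n)"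
  unfolding weighted_rep_def affine_A_def
  using assms omega_GL omega_relators by (intro group.presented_lift_hom[OF group_GL]) auto

lemma weighted_rep_gen:
  assumes "n \<ge> 3" "legal_weight (cycle_darts n) f" "i < n"
  shows "weighted_rep n f (affine_A_gen n i) = omega n f i"
  unfolding weighted_rep_def affine_A_gen_def
  using assms omega_GL omega_relators by (intro group.presented_lift_gen[OF group_GL]) auto

end

theory Submission
  imports Defs
begin

text \<open>In suitable vectors \<open>\<epsilon>\<^sub>m\<close> (\<open>m\<close> an integer) with \<open>\<epsilon>\<^sub>m\<^sub>+\<^sub>n = a\<^sup>-\<^sup>1 \<epsilon>\<^sub>m\<close> the representation is monomial:
  \<open>s\<^sub>i\<close> acts by exchanging \<open>\<epsilon>\<^sub>m\<close> and \<open>\<epsilon>\<^sub>m\<^sub>+\<^sub>1\<close> for all \<open>m\<close> congruent to \<open>i\<close>, that is, through the action of the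
  affine Coxeter group by affine permutations of the integers. Since \<open>a\<close> has infinite order, the \<open>\<epsilon>\<^sub>m\<close>
  are pairwise distinct, so a word acting trivially has the trivial affine permutation. It remains to see
  that such a word is trivial in the presented group: sorting an affine permutation along descents yields
  a normal form, which does not depend on the chosen descents by a diamond argument.\<close>

section \<open>Sorting affine permutations\<close>

text \<open>A state \<open>y\<close> encodes the affine permutation \<open>\<pi>\<close> with \<open>\<pi> (k) = k + y k\<close> for \<open>k < n\<close> and
  \<open>\<pi> (k + n) = \<pi> (k) + n\<close>. A step is composition of \<open>\<pi>\<close> with the transposition of \<open>i\<close> and \<open>i + 1\<close>, and a descent
  means \<open>\<pi> (i) > \<pi> (i + 1)\<close>; in terms of \<open>y\<close> the index \<open>n - 1\<close> needs no special treatment.\<close>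

definition cyclic_step :: "nat \<Rightarrow> nat \<Rightarrow> (nat \<Rightarrow> int) \<Rightarrow> nat \<Rightarrow> int" where
  "cyclic_step n i y = y(i := y (Suc i mod n) + 1, Suc i mod n := y i - 1)"

definition cyclic_descent :: "nat \<Rightarrow> nat \<Rightarrow> (nat \<Rightarrow> int) \<Rightarrow> bool" where
  "cyclic_descent n i y \<longleftrightarrow> y i > y (Suc i mod n) + 1"

text \<open>The termination measure of the sorting. It is quadratic because a step leaves the plain
  sum of the displacements unchanged when \<open>n\<close> is at least 2.\<close>

definition energy :: "nat \<Rightarrow> (nat \<Rightarrow> int) \<Rightarrow> nat" where
  "energy n y = nat (\<Sum>k<n. (y k)\<^sup>2)"

text \<open>Only the entries at \<open>i\<close> and its successor \<open>j\<close> change, and the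
  sum of their squares drops by twice \<open>y i - y j - 1\<close>, which is positive at a
  descent.\<close>

lemma energy_cyclic_step:
  assumes "i < n" "cyclic_descent n i y"
  shows "energy n (cyclic_step n i y) < energy n y"
proof -
  define j where "j = Suc i mod n"
  \<comment> \<open>Here \<open>j \<noteq> i\<close> comes from the descent itself, since
    \<open>y i > y i + 1\<close> is absurd.\<close>
  have j: "j < n" "j \<noteq> i" and d: "y i > y j + 1"
    using assms by (auto simp: j_def cyclic_descent_def)
  have split: "(\<Sum>k<n. (z k)\<^sup>2) = (z i)\<^sup>2 + ((z j)\<^sup>2 + (\<Sum>k\<in>{..<n} - {i} - {j}. (z k)\<^sup>2))"
    for z :: "nat \<Rightarrow> int"
    using assms(1) j by (simp add: sum.remove)
  have "(\<Sum>k\<in>{..<n} - {i} - {j}. (cyclic_step n i y k)\<^sup>2) = (\<Sum>k\<in>{..<n} - {i} - {j}. (y k)\<^sup>2)"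
    by (rule sum.cong) (auto simp: cyclic_step_def j_def)
  moreover have "cyclic_step n i y i = y j + 1" "cyclic_step n i y j = y i - 1"
    using j by (auto simp: cyclic_step_def j_def[symmetric])
  moreover have "(y j + 1)\<^sup>2 + (y i - 1)\<^sup>2 < (y i)\<^sup>2 + (y j)\<^sup>2"
    using d by (simp add: power2_eq_square algebra_simps)
  ultimately have "(\<Sum>k<n. (cyclic_step n i y k)\<^sup>2) < (\<Sum>k<n. (y k)\<^sup>2)"
    using split[of y] split[of "cyclic_step n i y"] by simp
  moreover have "0 \<le> (\<Sum>k<n. (cyclic_step n i y k)\<^sup>2)" by (rule sum_nonneg) simp
  ultimately show ?thesis by (simp add: energy_def)
qed

lemma Suc_mod_neq: "i < n \<Longrightarrow> 2 \<le> n \<Longrightarrow> Suc i mod n \<noteq> i"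
  by (cases "Suc i = n") auto

lemma Suc_Suc_mod_neq: "i < n \<Longrightarrow> 3 \<le> n \<Longrightarrow> Suc (Suc i mod n) mod n \<noteq> i"
  by (cases "Suc i = n"; cases "Suc (Suc i) = n") auto

lemma Suc_mod_inj: "i < n \<Longrightarrow> j < n \<Longrightarrow> Suc i mod n = Suc j mod n \<longleftrightarrow> i = j"
  by (cases "Suc i = n"; cases "Suc j = n") auto

lemma cyclic_step_involution:
  assumes "i < n" "2 \<le> n"
  shows "cyclic_step n i (cyclic_step n i y) = y"
  using Suc_mod_neq[OF assms] by (auto simp: cyclic_step_def)

text \<open>Sorting uses only the Coxeter relations, in braid and commutation form, so it is carried
  out in any group satisfying them; the instance needed later is \<open>affine_A n\<close>
  itself.\<close>

locale affine_A_quotient = group +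
  fixes n :: nat and s :: "nat \<Rightarrow> 'a"
  assumes three_le: "3 \<le> n"
    and s_closed [simp]: "i < n \<Longrightarrow> s i \<in> carrier G"
    and s_square: "i < n \<Longrightarrow> s i \<otimes> s i = \<one>"
    and s_braid: "(i, j) \<in> cycle_darts n \<Longrightarrow> s i \<otimes> s j \<otimes> s i = s j \<otimes> s i \<otimes> s j"
    and s_commute: "i < n \<Longrightarrow> j < n \<Longrightarrow> i \<noteq> j \<Longrightarrow> (i, j) \<notin> cycle_darts n \<Longrightarrow> s i \<otimes> s j = s j \<otimes> s i"
begin

text \<open>\<open>LEAST\<close> makes the sorting deterministic;
  \<open>normal_form_step_descent\<close> shows that any other descent gives the same element. The
  factor stands on the right because a step composes with the transposition on the right.\<close>

function normal_form :: "(nat \<Rightarrow> int) \<Rightarrow> 'a" where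
  "normal_form y =
    (if \<exists>i<n. cyclic_descent n i y
     then let i = (LEAST i. i < n \<and> cyclic_descent n i y)
       in normal_form (cyclic_step n i y) \<otimes> s i
     else \<one>)"
  by auto
termination
proof (relation "measure (energy n)")
  fix y i
  assume "\<exists>i<n. cyclic_descent n i y" "i = (LEAST i. i < n \<and> cyclic_descent n i y)"
  then have "i < n \<and> cyclic_descent n i y" by (metis (mono_tags, lifting) LeastI)
  then show "(cyclic_step n i y, y) \<in> measure (energy n)" by (simp add: energy_cyclic_step)
qed simp

declare normal_form.simps [simp del]

lemma normal_form_no_descent:
  "(\<And>i. i < n \<Longrightarrow> \<not> cyclic_descent n i y) \<Longrightarrow> normal_form y = \<one>"
  by (subst normal_form.simps) auto

lemma normal_form_descent:
  assumes "i < n" "cyclic_descent n i y"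
  obtains l where "l < n" "cyclic_descent n l y" "normal_form y = normal_form (cyclic_step n l y) \<otimes> s l"
proof
  let ?l = "LEAST i. i < n \<and> cyclic_descent n i y"
  show "?l < n" "cyclic_descent n ?l y" using LeastI[of "\<lambda>i. i < n \<and> cyclic_descent n i y"] assms by auto
  show "normal_form y = normal_form (cyclic_step n ?l y) \<otimes> s ?l"
    by (subst normal_form.simps) (use assms in \<open>auto simp: Let_def\<close>)
qed

lemma normal_form_closed [simp]: "normal_form y \<in> carrier G"
proof (induction y rule: measure_induct_rule[of "energy n"])
  case (less y)
  show ?case
  proof (cases "\<exists>i<n. cyclic_descent n i y")
    case True
    then obtain l where "l < n" "cyclic_descent n l y" "normal_form y = normal_form (cyclic_step n l y) \<otimes> s l"
      using normal_form_descent by metis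
    then show ?thesis using less energy_cyclic_step by simp
  next
    case False
    then show ?thesis by (simp add: normal_form_no_descent)
  qed
qed

text \<open>Newman's argument: two descents of the same state can be joined by a commutation or a braid
  relation, passing only through states of smaller energy.\<close>

lemma normal_form_step_descent:
  assumes "i < n" "cyclic_descent n i y"
  shows "normal_form y = normal_form (cyclic_step n i y) \<otimes> s i"
  using assms
proof (induction y arbitrary: i rule: measure_induct_rule[of "energy n"])
  case (less y)
  note down = energy_cyclic_step
  have braid: "normal_form (cyclic_step n i y) \<otimes> s i = normal_form (cyclic_step n j y) \<otimes> s j"
    if i: "i < n" and j: "j = Suc i mod n" and d: "cyclic_descent n i y" "cyclic_descent n j y" for i j
  proof -
    define k where "k = Suc j mod n"
    have jk: "j < n" "k < n" using i j k_def by auto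
    have ne: "i \<noteq> j" "j \<noteq> k" "i \<noteq> k"
      using Suc_mod_neq[of i n] Suc_mod_neq[of j n] Suc_Suc_mod_neq[of i n] three_le i jk
      unfolding k_def j by auto
    let ?i = "cyclic_step n i" and ?j = "cyclic_step n j"
    \<comment> \<open>The values of the permutation at three consecutive places are decreasing. Both
      zigzags reverse them by descents only, so the induction hypothesis covers every intermediate
      state.\<close>
    have d1: "cyclic_descent n j (?i y)" "cyclic_descent n i (?j (?i y))"
      "cyclic_descent n i (?j y)" "cyclic_descent n j (?i (?j y))"
      using d ne by (auto simp: cyclic_descent_def cyclic_step_def j[symmetric] k_def[symmetric])
    have eq: "?i (?j (?i y)) = ?j (?i (?j y))"
      using ne by (auto simp: cyclic_step_def j[symmetric] k_def[symmetric])
    have e: "energy n (?i y) < energy n y" "energy n (?j (?i y)) < energy n y"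
       "energy n (?j y) < energy n y" "energy n (?i (?j y)) < energy n y"
      using down[OF i d(1)] down[OF jk(1) d(2)] down[OF jk(1) d1(1)] down[OF i d1(3)] by auto
    let ?N = "normal_form (?i (?j (?i y)))"
    have "normal_form (?i y) \<otimes> s i = ?N \<otimes> (s i \<otimes> s j \<otimes> s i)"
      using less.IH[OF e(1) jk(1) d1(1)] less.IH[OF e(2) i d1(2)] i jk by (simp add: m_assoc)
    also have "s i \<otimes> s j \<otimes> s i = s j \<otimes> s i \<otimes> s j"
      using i jk by (intro s_braid) (auto simp: cycle_darts_def j)
    also have "?N \<otimes> (s j \<otimes> s i \<otimes> s j) = normal_form (?j y) \<otimes> s j"
      using less.IH[OF e(3) i d1(3)] less.IH[OF e(4) jk(1) d1(4)] i jk by (simp add: m_assoc eq)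
    finally show ?thesis .
  qed
  obtain l where l: "l < n" "cyclic_descent n l y"
    "normal_form y = normal_form (cyclic_step n l y) \<otimes> s l"
    using normal_form_descent less.prems by blast
  \<comment> \<open>The two descents coincide, are neighbours in one of the two orders (both handled
    by \<open>braid\<close>), or are far apart and commute.\<close>
  consider "i = l" | "l = Suc i mod n" | "i = Suc l mod n" | "i \<noteq> l" "(i, l) \<notin> cycle_darts n"
    using less.prems(1) l(1) by (auto simp: cycle_darts_def)
  then show ?case
  proof cases
    case 4
    let ?i = "cyclic_step n i" and ?l = "cyclic_step n l"
    have ne: "i \<noteq> l" "Suc i mod n \<noteq> l" "i \<noteq> Suc l mod n" "Suc i mod n \<noteq> Suc l mod n"
      "Suc i mod n \<noteq> i" "Suc l mod n \<noteq> l"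
      using 4 less.prems(1) l(1) three_le Suc_mod_neq Suc_mod_inj by (auto simp: cycle_darts_def)
    have d: "cyclic_descent n i (?l y)" "cyclic_descent n l (?i y)"
      using less.prems(2) l(2) ne by (auto simp: cyclic_descent_def cyclic_step_def)
    have eq: "?i (?l y) = ?l (?i y)"
      using ne by (auto simp: cyclic_step_def)
    have "normal_form y = normal_form (?i (?l y)) \<otimes> (s i \<otimes> s l)"
      using less.IH[OF down[OF l(1,2)] less.prems(1) d(1)] l less.prems(1) by (simp add: m_assoc)
    also have "s i \<otimes> s l = s l \<otimes> s i" using 4 l less.prems by (intro s_commute) auto
    also have "normal_form (?i (?l y)) \<otimes> (s l \<otimes> s i) = normal_form (?i y) \<otimes> s i"
      using less.IH[OF down[OF less.prems] l(1) d(2)] l less.prems(1) by (simp add: m_assoc eq)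
    finally show ?thesis .
  qed (use l less.prems braid in auto)
qed

text \<open>Either the step or its undoing is a descent. The excluded tie, which no permutation has,
  is a fixed point of \<open>cyclic_step\<close>, where the claim would force
  \<open>s i = \<one>\<close>.\<close>

lemma normal_form_step:
  assumes i: "i < n" and ne: "y i \<noteq> y (Suc i mod n) + 1"
  shows "normal_form (cyclic_step n i y) = normal_form y \<otimes> s i"
proof (cases "cyclic_descent n i y")
  case True
  then show ?thesis using normal_form_step_descent[OF i True] i by (simp add: m_assoc s_square)
next
  case False
  have "Suc i mod n \<noteq> i" using Suc_mod_neq i three_le by auto
  then have "cyclic_descent n i (cyclic_step n i y)"
    using False ne by (auto simp: cyclic_descent_def cyclic_step_def)
  then show ?thesis using normal_form_step_descent[OF i] cyclic_step_involution[OF i] three_le by simp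
qed

end

section \<open>The monomial form of the representation\<close>

lemma div_add_one_not_dvd:
  fixes t n :: int
  assumes "0 < n" "\<not> n dvd t + 1"
  shows "(t + 1) div n = t div n"
proof (rule int_div_pos_eq)
  show "t + 1 = n * (t div n) + (t mod n + 1)" by simp
  then have "t mod n + 1 \<noteq> n" using assms(2) by (metis dvd_add_triv_right_iff dvd_triv_left)
  then show "t mod n + 1 < n" "0 \<le> t mod n + 1"
    using pos_mod_bound[OF assms(1), of t] pos_mod_sign[OF assms(1), of t] by auto
qed

lemma div_add_one_dvd:
  fixes t n :: int
  assumes "0 < n" "n dvd t + 1"
  shows "(t + 1) div n = t div n + 1"
proof -
  obtain k where k: "t + 1 = n * k" using assms(2) by blast
  have "t div n = k - 1"
    by (rule int_div_pos_eq[where r = "n - 1"]) (use k assms(1) in \<open>auto simp: algebra_simps\<close>)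
  then show ?thesis using k assms(1) by simp
qed

text \<open>The vectors \<open>\<epsilon>\<^sub>m\<close> are \<open>affine_vec n f m\<close>, and \<open>a = path_weight n f n\<close>. They are found from the ansatz
  that \<open>\<epsilon>\<^sub>i - \<epsilon>\<^sub>i\<^sub>+\<^sub>1\<close> is proportional to the \<open>i\<close>-th basis vector, which \<open>\<omega>\<^sub>i\<close> negates.\<close>

definition path_weight :: "nat \<Rightarrow> (nat \<times> nat \<Rightarrow> complex) \<Rightarrow> nat \<Rightarrow> complex" where
  "path_weight n f c = (\<Prod>k<c. f (k, (k + 1) mod n))"

text \<open>From \<open>m\<close> to \<open>m + 1\<close> the exponent changes only at
  \<open>c\<close> congruent to \<open>m\<close>, as the ansatz demands. Dividing by the path weight
  absorbs the single edge weights, so that only their product around the cycle remains.\<close>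

definition affine_coord :: "nat \<Rightarrow> (nat \<times> nat \<Rightarrow> complex) \<Rightarrow> int \<Rightarrow> nat \<Rightarrow> complex" where
  "affine_coord n f m c = path_weight n f n powi ((int c - m) div int n) / path_weight n f c"

definition affine_vec :: "nat \<Rightarrow> (nat \<times> nat \<Rightarrow> complex) \<Rightarrow> int \<Rightarrow> complex vec" where
  "affine_vec n f m = vec n (affine_coord n f m)"

text \<open>The residue of \<open>m\<close> is tested through \<open>int i - m\<close>, the
  numerator of the exponent in row \<open>i\<close> of \<open>affine_coord\<close>.\<close>

definition affine_transp :: "nat \<Rightarrow> nat \<Rightarrow> int \<Rightarrow> int" where
  "affine_transp n i m =
    (if int n dvd int i - m then m + 1 else if int n dvd int i - m + 1 then m - 1 else m)"

lemma legal_weightD: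
  assumes "legal_weight D f" "(u, v) \<in> D"
  shows "f (u, v) \<noteq> 0" "f (u, v) = inverse (f (v, u))"
  using bspec[OF assms(1)[unfolded legal_weight_def] assms(2)] unfolding prod.case by blast+

lemma path_weight_nonzero:
  assumes "legal_weight (cycle_darts n) f" "c \<le> n"
  shows "path_weight n f c \<noteq> 0"
proof -
  have "f (k, (k + 1) mod n) \<noteq> 0" if "k < c" for k
    using assms that by (intro legal_weightD(1)) (auto simp: cycle_darts_def)
  then show ?thesis by (simp add: path_weight_def)
qed

lemma path_weight_Suc: "path_weight n f (Suc c) = path_weight n f c * f (c, Suc c mod n)"
  by (simp add: path_weight_def)

text \<open>The edge weight is a quotient of consecutive path weights, so the weighted next
  coordinate is coordinate \<open>i\<close> itself with \<open>m\<close> lowered by one. At the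
  closing edge, the full turn supplies one factor \<open>path_weight n f n\<close>, matching the
  jump of the floor by one.\<close>

lemma affine_coord_next:
  assumes f: "legal_weight (cycle_darts n) f" and i: "i < n"
  shows "f (i, Suc i mod n) * affine_coord n f m (Suc i mod n) =
    path_weight n f n powi ((int i + 1 - m) div int n) / path_weight n f i"
proof -
  let ?P = "path_weight n f"
  have nz: "?P c \<noteq> 0" if "c \<le> n" for c using path_weight_nonzero[OF f that] .
  have fi: "f (i, Suc i mod n) = ?P (Suc i) / ?P i"
    using nz[of i] i by (simp add: path_weight_Suc)
  show ?thesis
  proof (cases "Suc i = n")
    case True
    have "(int i + 1 - m) div int n = (- m) div int n + 1"
      using True i by (subst div_add_self2[symmetric]) (auto simp: algebra_simps)
    moreover have "f (i, 0) = ?P n / ?P i" using fi True by simp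
    ultimately show ?thesis
      using True nz[of n] nz[of i] by (simp add: affine_coord_def power_int_add path_weight_def[of n f 0])
  next
    case False
    then have "Suc i mod n = Suc i" "Suc i < n" using i by auto
    then show ?thesis using nz[of "Suc i"] fi by (simp add: affine_coord_def add_ac)
  qed
qed

text \<open>This inverts \<open>affine_coord_next\<close> at \<open>m + 1\<close>, legality giving
  the reversed edge the inverse weight.\<close>

lemma affine_coord_prev:
  assumes f: "legal_weight (cycle_darts n) f" and h: "h < n"
  shows "f (Suc h mod n, h) * affine_coord n f m h =
    path_weight n f n powi ((int (Suc h mod n) - 1 - m) div int n) / path_weight n f (Suc h mod n)"
proof -
  have "f (h, Suc h mod n) \<noteq> 0" "f (Suc h mod n, h) = inverse (f (h, Suc h mod n))"
    using h by (intro legal_weightD[OF f]; simp add: cycle_darts_def)+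
  moreover have "f (h, Suc h mod n) * affine_coord n f (m + 1) (Suc h mod n) = affine_coord n f m h"
    using affine_coord_next[OF f h, of "m + 1"] by (simp add: affine_coord_def)
  ultimately have "f (Suc h mod n, h) * affine_coord n f m h = affine_coord n f (m + 1) (Suc h mod n)"
    by (metis left_inverse mult.assoc mult_1)
  then show ?thesis by (simp add: affine_coord_def algebra_simps)
qed

text \<open>With \<open>t = int i - m\<close>, row \<open>i\<close> combines the powers with
  exponents the floors of \<open>t + 1\<close>, \<open>t - 1\<close> and, negated, \<open>t\<close>
  over \<open>n\<close>. At most one of \<open>t\<close>, \<open>t + 1\<close> is divisible by
  \<open>n\<close>, so the negated power cancels a neighbour. The other rows never meet a jump of
  the floor.\<close>

lemma omega_mult_affine_vec:
  assumes n: "3 \<le> n" and f: "legal_weight (cycle_darts n) f" and i: "i < n"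
  shows "omega n f i *\<^sub>v affine_vec n f m = affine_vec n f (affine_transp n i m)"
proof (rule eq_vecI)
  fix r assume "r < dim_vec (affine_vec n f (affine_transp n i m))"
  then have r: "r < n" by (simp add: affine_vec_def)
  have n0: "0 < int n" using n by simp
  let ?x = "affine_coord n f m"
  have entry: "(omega n f i *\<^sub>v affine_vec n f m) $ r = (\<Sum>k<n. omega n f i $$ (r, k) * ?x k)"
    using r by (simp add: affine_vec_def scalar_prod_def lessThan_atLeast0)
  have "(\<Sum>k<n. omega n f i $$ (r, k) * ?x k) = affine_coord n f (affine_transp n i m) r"
  proof (cases "r = i")
    case False
    have "(\<Sum>k<n. omega n f i $$ (r, k) * ?x k) = (\<Sum>k<n. if k = r then ?x k else 0)"
      by (rule sum.cong) (use False r in \<open>auto simp: omega_def\<close>)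
    also have "\<dots> = ?x r" using r by simp
    also have "?x r = affine_coord n f (affine_transp n i m) r"
    proof -
      have dist: "\<not> int n dvd int r - int i"
      proof
        assume "int n dvd int r - int i"
        then have "int r mod int n = int i mod int n" by (simp add: mod_eq_dvd_iff)
        then show False using r i False by simp
      qed
      have "\<not> int n dvd int r - m" if "int n dvd int i - m"
        using dist dvd_diff[of "int n" "int r - m" "int i - m"] that by auto
      moreover have "\<not> int n dvd int r - m + 1" if "int n dvd int i - m + 1"
        using dist dvd_diff[of "int n" "int r - m + 1" "int i - m + 1"] that by auto
      ultimately show ?thesis
        using div_add_one_not_dvd[OF n0, of "int r - m - 1"] div_add_one_not_dvd[OF n0, of "int r - m"]
        by (auto simp: affine_coord_def affine_transp_def algebra_simps)
    qed
    finally show ?thesis .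
  next
    case True
    define j where "j = Suc i mod n"
    \<comment> \<open>The predecessor on the cycle; on naturals \<open>i - 1\<close> would stay at
      0.\<close>
    define h where "h = (if i = 0 then n - 1 else i - 1)"
    have h: "h < n" "i = Suc h mod n" using i n by (auto simp: h_def)
    have j: "j < n" using i by (simp add: j_def)
    have ne: "j \<noteq> i" "h \<noteq> i" "h \<noteq> j"
      using Suc_mod_neq[of i n] Suc_mod_neq[of h n] Suc_Suc_mod_neq[of h n] i h n by (auto simp: j_def)
    have darts: "(i, c) \<in> cycle_darts n \<longleftrightarrow> c = j \<or> c = h" if "c < n" for c
      using that i h j Suc_mod_inj[of c n h] by (auto simp: cycle_darts_def j_def)
    have "(\<Sum>k<n. omega n f i $$ (r, k) * ?x k) =
        (\<Sum>k\<in>{i, j, h}. omega n f i $$ (i, k) * ?x k)"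
      unfolding True by (rule sum.mono_neutral_right)
        (use i j h(1) darts in \<open>auto simp: omega_def\<close>)
    also have "\<dots> = - ?x i + f (i, j) * ?x j + f (i, h) * ?x h"
      using ne i j h(1) darts by (simp add: omega_def)
    also have "\<dots> = (path_weight n f n powi ((int i - m + 1) div int n)
        + path_weight n f n powi ((int i - m - 1) div int n)
        - path_weight n f n powi ((int i - m) div int n)) / path_weight n f i"
      using affine_coord_next[OF f i, of m] affine_coord_prev[OF f h(1), of m]
      by (simp add: j_def[symmetric] h(2)[symmetric] affine_coord_def diff_divide_distrib
          add_divide_distrib algebra_simps)
    also have "\<dots> = affine_coord n f (affine_transp n i m) i"
    proof -
      define t where "t = int i - m"
      have dvd_once: "\<not> int n dvd t + 1" if "int n dvd t"
        using that n dvd_diff[of "int n" "t + 1" t] by auto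
      have "(t + 1) div int n = (if int n dvd t + 1 then t div int n + 1 else t div int n)"
        "t div int n = (if int n dvd t then (t - 1) div int n + 1 else (t - 1) div int n)"
        using div_add_one_not_dvd[OF n0, of t] div_add_one_dvd[OF n0, of t]
          div_add_one_not_dvd[OF n0, of "t - 1"] div_add_one_dvd[OF n0, of "t - 1"] by auto
      then show ?thesis
        using dvd_once unfolding affine_coord_def affine_transp_def t_def[symmetric]
        by (auto simp: t_def algebra_simps)
    qed
    finally show ?thesis by (simp add: True)
  qed
  then show "(omega n f i *\<^sub>v affine_vec n f m) $ r = affine_vec n f (affine_transp n i m) $ r"
    using r entry by (simp add: affine_vec_def)
qed (simp add: affine_vec_def)

section \<open>Distinctness of the vectors and the action of words on them\<close>

lemma powi_inj_infinite_order:
  fixes a :: complex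
  assumes a: "a \<noteq> 0" "\<forall>k::nat. k > 0 \<longrightarrow> a ^ k \<noteq> 1" and eq: "a powi p = a powi q"
  shows "p = q"
proof (rule ccontr)
  assume "p \<noteq> q"
  moreover have "a powi (p - q) = 1" "a powi (q - p) = 1" using a(1) eq by (simp_all add: power_int_diff)
  ultimately show False
    using a(2)[rule_format, of "nat (p - q)"] a(2)[rule_format, of "nat (q - p)"]
    by (cases "p > q") (simp_all add: power_int_def)
qed

text \<open>At the coordinate \<open>c\<close> congruent to the smaller index \<open>m\<close>, the
  number \<open>int c - m\<close> is an exact multiple of \<open>n\<close>, so every larger index
  has a strictly smaller exponent there. Infinite order separates the powers.\<close>

lemma affine_vec_inj:
  assumes n: "0 < n" and f: "legal_weight (cycle_darts n) f"
    and a: "\<forall>k::nat. k > 0 \<longrightarrow> path_weight n f n ^ k \<noteq> 1"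
  shows "inj (affine_vec n f)"
proof (rule linorder_injI)
  fix m m' :: int assume less: "m < m'"
  define c where "c = nat (m mod int n)"
  have c: "int c = m mod int n" "c < n" using n by (auto simp: c_def nat_less_iff)
  obtain q where q: "int c - m = int n * q"
    using mod_eq_dvd_iff[of "int c" "int n" m] c(1) by (auto simp: dvd_def)
  show "affine_vec n f m \<noteq> affine_vec n f m'"
  proof
    assume "affine_vec n f m = affine_vec n f m'"
    then have "affine_coord n f m c = affine_coord n f m' c"
      using c(2) by (metis affine_vec_def index_vec)
    then have "(int c - m) div int n = (int c - m') div int n"
      using powi_inj_infinite_order[OF path_weight_nonzero[OF f order_refl] a]
        path_weight_nonzero[OF f, of c] c(2) by (simp add: affine_coord_def)
    moreover have "(int c - m') div int n * int n \<le> int c - m'"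
      using pos_mod_sign[of "int n" "int c - m'"] n by (simp add: minus_mod_eq_div_mult[symmetric])
    ultimately show False using q less n by (simp add: mult.commute)
  qed
qed

text \<open>The start is the identity permutation. The sign of a letter is dropped because the
  generators are involutions.\<close>

definition word_state :: "nat \<Rightarrow> nat word \<Rightarrow> nat \<Rightarrow> int" where
  "word_state n w = foldl (\<lambda>y l. cyclic_step n (snd l) y) (\<lambda>_. 0) w"

lemma word_state_simps [simp]:
  "word_state n [] = (\<lambda>_. 0)"
  "word_state n (w @ [l]) = cyclic_step n (snd l) (word_state n w)"
  by (simp_all add: word_state_def)

text \<open>With \<open>\<pi> (m) = m + y (m mod n)\<close>, this says that a step is composition of
  \<open>\<pi>\<close> with the affine transposition on the right.\<close>

lemma affine_transp_cyclic_step: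
  assumes n: "2 \<le> n" and i: "i < n"
  shows "y (nat (affine_transp n i m mod int n)) + affine_transp n i m =
    cyclic_step n i y (nat (m mod int n)) + m"
proof -
  have ne: "Suc i mod n \<noteq> i" using Suc_mod_neq[OF i n] .
  have imod: "int i mod int n = int i" using i by simp
  have smod: "(int i + 1) mod int n = int (Suc i mod n)" by (simp add: zmod_int add.commute)
  have at_i: "int n dvd int i - m \<longleftrightarrow> m mod int n = int i"
    using mod_eq_dvd_iff[of "int i" "int n" m] imod by auto
  have at_j: "int n dvd int i - m + 1 \<longleftrightarrow> m mod int n = int (Suc i mod n)"
    using mod_eq_dvd_iff[of "int i + 1" "int n" m] smod by (auto simp: algebra_simps)
  consider "m mod int n = int i" | "m mod int n = int (Suc i mod n)"
    | "m mod int n \<noteq> int i" "m mod int n \<noteq> int (Suc i mod n)" by blast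
  then show ?thesis
  proof cases
    case 1
    then have "(m + 1) mod int n = int (Suc i mod n)"
      using smod by (metis mod_add_left_eq)
    then show ?thesis using 1 at_i ne by (simp add: affine_transp_def cyclic_step_def)
  next
    case 2
    then have "(m - 1) mod int n = int i"
      using smod imod by (metis add_diff_cancel_right' mod_diff_left_eq)
    then show ?thesis using 2 at_i at_j ne by (simp add: affine_transp_def cyclic_step_def)
  next
    case 3
    have "int (nat (m mod int n)) = m mod int n" using n by simp
    then have "nat (m mod int n) \<noteq> i" "nat (m mod int n) \<noteq> Suc i mod n" using 3 by metis+
    then show ?thesis using 3 at_i at_j by (simp add: affine_transp_def cyclic_step_def)
  qed
qed

lemma letter_eval_omega:
  assumes "snd l < n"
  shows "letter_eval (GL n) (omega n f) l = omega n f (snd l)"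
proof -
  interpret group "GL n" by (rule group_GL)
  have "omega n f (snd l) \<otimes>\<^bsub>GL n\<^esub> omega n f (snd l) = \<one>\<^bsub>GL n\<^esub>"
    using omega_square[of "1\<^sub>m n" n "snd l" f] assms by (simp add: GL_simps right_mult_one_mat[of _ n n])
  then have "inv\<^bsub>GL n\<^esub> omega n f (snd l) = omega n f (snd l)"
    using assms omega_GL by (intro inv_equality) auto
  then show ?thesis by (cases l) (auto simp: letter_eval_def)
qed

text \<open>The index on the right is \<open>\<pi> (m)\<close>. The last letter acts first on
  vectors, hence the induction from the end of the word.\<close>

lemma word_eval_affine_vec:
  assumes n: "3 \<le> n" and f: "legal_weight (cycle_darts n) f" and w: "w \<in> words {..<n}"
  shows "word_eval (GL n) (omega n f) w *\<^sub>v affine_vec n f m =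
    affine_vec n f (word_state n w (nat (m mod int n)) + m)"
  using w
proof (induction w arbitrary: m rule: rev_induct)
  case Nil
  have "affine_vec n f m \<in> carrier_vec n" by (simp add: affine_vec_def)
  then show ?case by (simp add: word_eval_def GL_simps)
next
  case (snoc l w)
  then have l: "snd l < n" and w: "w \<in> words {..<n}" by auto
  have \<phi>: "omega n f \<in> {..<n} \<rightarrow> carrier (GL n)" by (auto intro: omega_GL)
  let ?M = "word_eval (GL n) (omega n f) w"
  have M: "?M \<in> carrier_mat n n"
    using group.word_eval_closed[OF group_GL \<phi> w] by (simp add: GL_simps)
  have "word_eval (GL n) (omega n f) (w @ [l]) = ?M * omega n f (snd l)"
    using group.word_eval_append[OF group_GL \<phi> w, of "[l]"] l
    by (simp add: word_eval_def letter_eval_omega GL_simps right_mult_one_mat[of _ n n])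
  moreover have "?M * omega n f (snd l) *\<^sub>v affine_vec n f m
      = ?M *\<^sub>v (omega n f (snd l) *\<^sub>v affine_vec n f m)"
    using M omega_carrier_mat(1) by (rule assoc_mult_mat_vec) (simp add: affine_vec_def)
  ultimately show ?case
    using snoc.IH[OF w, of "affine_transp n (snd l) m"] affine_transp_cyclic_step[of n "snd l"] l n
    by (simp add: omega_mult_affine_vec[OF n f])
qed

text \<open>This provides the hypothesis of \<open>normal_form_step\<close>. A tie would make an
  invertible matrix send two distinct vectors \<open>\<epsilon>\<^sub>i\<close> and
  \<open>\<epsilon>\<^sub>i\<^sub>+\<^sub>1\<close> to the same one.\<close>

lemma word_state_nondegenerate:
  assumes n: "3 \<le> n" and f: "legal_weight (cycle_darts n) f"
    and a: "\<forall>k::nat. k > 0 \<longrightarrow> path_weight n f n ^ k \<noteq> 1"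
    and w: "w \<in> words {..<n}" and i: "i < n"
  shows "word_state n w i \<noteq> word_state n w (Suc i mod n) + 1"
proof
  assume eq: "word_state n w i = word_state n w (Suc i mod n) + 1"
  let ?M = "word_eval (GL n) (omega n f) w"
  have "omega n f \<in> {..<n} \<rightarrow> carrier (GL n)" by (auto intro: omega_GL)
  then have "?M \<in> carrier (GL n)" using w by (rule group.word_eval_closed[OF group_GL])
  then obtain B where B: "B \<in> carrier_mat n n" "?M \<in> carrier_mat n n" "B * ?M = 1\<^sub>m n"
    by (auto simp: GL_simps)
  have cancel: "B *\<^sub>v (?M *\<^sub>v affine_vec n f m) = affine_vec n f m" for m
    using assoc_mult_mat_vec[OF B(1,2), of "affine_vec n f m"] B(3) by (simp add: affine_vec_def)
  have "nat ((int i + 1) mod int n) = Suc i mod n"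
    by (metis add.commute nat_int of_nat_Suc zmod_int)
  then have "?M *\<^sub>v affine_vec n f (int i) = ?M *\<^sub>v affine_vec n f (int i + 1)"
    using eq i by (simp add: word_eval_affine_vec[OF n f w] add_ac)
  then have "affine_vec n f (int i) = affine_vec n f (int i + 1)" using cancel by metis
  then show False using affine_vec_inj[OF _ f a] n by (auto dest: injD)
qed

section \<open>Faithfulness\<close>

lemma affine_A_gen_closed: "i < n \<Longrightarrow> affine_A_gen n i \<in> carrier (affine_A n)"
  by (auto simp: affine_A_gen_def affine_A_def presented_gen_def carrier_presented_group)

text \<open>Each relator is split into two halves that are inverse to each other; as generators are
  their own inverses, inverting a half merely reverses it.\<close>

lemma affine_A_relations: "3 \<le> n \<Longrightarrow> affine_A_quotient (affine_A n) n (affine_A_gen n)"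
proof -
  assume n: "3 \<le> n"
  interpret group "affine_A n" unfolding affine_A_def by (rule group_presented_group)
  let ?s = "affine_A_gen n"
  note mult = mult_presented_group[of _ "{..<n}" _ "affine_A_relators n"]
  note gen = affine_A_gen_def presented_gen_def affine_A_def
  have rel: "pres_rel {..<n} (affine_A_relators n) `` {r} = \<one>\<^bsub>affine_A n\<^esub>"
    if "r \<in> affine_A_relators n" "r \<in> words {..<n}" for r
    using pres_eq.relator[of "[]" "{..<n}" "[]" r "affine_A_relators n"] that
    by (simp add: affine_A_def one_presented_group pres_class_eq_iff)
  have square: "?s i \<otimes>\<^bsub>affine_A n\<^esub> ?s i = \<one>\<^bsub>affine_A n\<^esub>" if "i < n" for i
  proof -
    have "[(True, i), (True, i)] \<in> affine_A_relators n" using that by (simp add: affine_A_relators_def)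
    then show ?thesis using rel[of "[(True, i), (True, i)]"] that by (simp add: gen mult)
  qed
  have inv: "inv\<^bsub>affine_A n\<^esub> ?s i = ?s i" if "i < n" for i
    using square that affine_A_gen_closed by (intro inv_equality) auto
  show ?thesis
  proof (unfold_locales)
    fix i j assume ij: "(i, j) \<in> cycle_darts n"
    then have l: "i < n" "j < n" by (auto simp: cycle_darts_def)
    have "concat (replicate 3 [(True, i), (True, j)]) \<in> affine_A_relators n"
      using ij by (auto simp: affine_A_relators_def)
    then have "(?s i \<otimes>\<^bsub>affine_A n\<^esub> ?s j \<otimes>\<^bsub>affine_A n\<^esub> ?s i) \<otimes>\<^bsub>affine_A n\<^esub>
        (?s j \<otimes>\<^bsub>affine_A n\<^esub> ?s i \<otimes>\<^bsub>affine_A n\<^esub> ?s j) = \<one>\<^bsub>affine_A n\<^esub>"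
      using rel[of "concat (replicate 3 [(True, i), (True, j)])"] l
      by (simp add: gen mult numeral_eq_Suc)
    then have "?s i \<otimes>\<^bsub>affine_A n\<^esub> ?s j \<otimes>\<^bsub>affine_A n\<^esub> ?s i =
        inv\<^bsub>affine_A n\<^esub> (?s j \<otimes>\<^bsub>affine_A n\<^esub> ?s i \<otimes>\<^bsub>affine_A n\<^esub> ?s j)"
      using l affine_A_gen_closed by (intro inv_equality[symmetric]) auto
    then show "?s i \<otimes>\<^bsub>affine_A n\<^esub> ?s j \<otimes>\<^bsub>affine_A n\<^esub> ?s i =
        ?s j \<otimes>\<^bsub>affine_A n\<^esub> ?s i \<otimes>\<^bsub>affine_A n\<^esub> ?s j"
      using l affine_A_gen_closed by (simp add: inv_mult_group inv m_assoc)
  next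
    fix i j assume ij: "i < n" "j < n" "i \<noteq> j" "(i, j) \<notin> cycle_darts n"
    then have "concat (replicate 2 [(True, i), (True, j)]) \<in> affine_A_relators n"
      by (auto simp: affine_A_relators_def)
    then have "(?s i \<otimes>\<^bsub>affine_A n\<^esub> ?s j) \<otimes>\<^bsub>affine_A n\<^esub> (?s i \<otimes>\<^bsub>affine_A n\<^esub> ?s j) = \<one>\<^bsub>affine_A n\<^esub>"
      using rel[of "concat (replicate 2 [(True, i), (True, j)])"] ij
      by (simp add: gen mult numeral_eq_Suc)
    then have "?s i \<otimes>\<^bsub>affine_A n\<^esub> ?s j = inv\<^bsub>affine_A n\<^esub> (?s i \<otimes>\<^bsub>affine_A n\<^esub> ?s j)"
      using ij affine_A_gen_closed by (intro inv_equality[symmetric]) auto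
    then show "?s i \<otimes>\<^bsub>affine_A n\<^esub> ?s j = ?s j \<otimes>\<^bsub>affine_A n\<^esub> ?s i"
      using ij affine_A_gen_closed by (simp add: inv_mult_group inv)
  qed (use n square affine_A_gen_closed in auto)
qed

abbreviation affine_A_class :: "nat \<Rightarrow> nat word \<Rightarrow> nat word set" where
  "affine_A_class n w \<equiv> pres_rel {..<n} (affine_A_relators n) `` {w}"

text \<open>A formal inverse has the same class as its generator, by the square relators, matching
  the dropped signs in \<open>word_state\<close>.\<close>

lemma affine_A_class_snoc:
  assumes "3 \<le> n" and w: "w \<in> words {..<n}" and l: "snd l < n"
  shows "affine_A_class n (w @ [l]) = affine_A_class n w \<otimes>\<^bsub>affine_A n\<^esub> affine_A_gen n (snd l)"
proof -
  interpret affine_A_quotient "affine_A n" n "affine_A_gen n" using assms(1) by (rule affine_A_relations)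
  note mult = mult_presented_group[of _ "{..<n}" _ "affine_A_relators n"]
  obtain b i where bi: "l = (b, i)" by (cases l)
  have "affine_A_class n [l] = affine_A_gen n i"
  proof (cases b)
    case False
    have "affine_A_class n [(False, i)] \<otimes>\<^bsub>affine_A n\<^esub> affine_A_gen n i = \<one>\<^bsub>affine_A n\<^esub>"
      using l bi pres_eq.cancel[of "[]" "{..<n}" "[]" i "affine_A_relators n" False]
      by (simp add: affine_A_def affine_A_gen_def presented_gen_def mult one_presented_group pres_class_eq_iff)
    moreover have "affine_A_class n [(False, i)] \<in> carrier (affine_A n)"
      using l bi by (auto simp: affine_A_def carrier_presented_group)
    ultimately show ?thesis
      using s_square[of i] s_closed[of i] l bi False by (metis inv_equality snd_conv)
  qed (simp add: bi affine_A_gen_def presented_gen_def)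
  moreover have "affine_A_class n (w @ [l]) = affine_A_class n w \<otimes>\<^bsub>affine_A n\<^esub> affine_A_class n [l]"
    using w l by (simp add: affine_A_def mult)
  ultimately show ?thesis by (simp add: bi)
qed

lemma generate_affine_A:
  assumes n: "3 \<le> n"
  shows "generate (affine_A n) (affine_A_gen n ` {..<n}) = carrier (affine_A n)"
proof
  interpret group "affine_A n" unfolding affine_A_def by (rule group_presented_group)
  show "generate (affine_A n) (affine_A_gen n ` {..<n}) \<subseteq> carrier (affine_A n)"
    by (rule generate_incl) (auto intro: affine_A_gen_closed)
  have "affine_A_class n w \<in> generate (affine_A n) (affine_A_gen n ` {..<n})"
    if "w \<in> words {..<n}" for w
    using that
  proof (induction w rule: rev_induct)
    case Nil
    then show ?case using generate.one[of "affine_A n"] by (simp add: affine_A_def one_presented_group)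
  next
    case (snoc l w)
    then show ?case using n by (auto simp: affine_A_class_snoc intro!: generate.eng intro: generate.incl)
  qed
  then show "carrier (affine_A n) \<subseteq> generate (affine_A n) (affine_A_gen n ` {..<n})"
    by (auto simp: affine_A_def carrier_presented_group)
qed

text \<open>The class of any word is the normal form of its state, so the permutation determines the
  class. The identity matrix fixes every vector, which by their distinctness forces the identity
  permutation.\<close>

lemma affine_A_class_trivial:
  assumes n: "3 \<le> n" and f: "legal_weight (cycle_darts n) f"
    and a: "\<forall>k::nat. k > 0 \<longrightarrow> path_weight n f n ^ k \<noteq> 1"
    and w: "w \<in> words {..<n}" and one: "word_eval (GL n) (omega n f) w = 1\<^sub>m n"
  shows "affine_A_class n w = \<one>\<^bsub>affine_A n\<^esub>"
proof -
  interpret affine_A_quotient "affine_A n" n "affine_A_gen n" using n by (rule affine_A_relations)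
  have "affine_A_class n w = normal_form (word_state n w)"
    using w
  proof (induction w rule: rev_induct)
    case Nil
    have "normal_form (\<lambda>_. 0) = \<one>\<^bsub>affine_A n\<^esub>"
      by (rule normal_form_no_descent) (simp add: cyclic_descent_def)
    then show ?case by (simp add: affine_A_def one_presented_group)
  next
    case (snoc l w)
    then have l: "snd l < n" and w: "w \<in> words {..<n}" by auto
    have "affine_A_class n w = normal_form (word_state n w)" using snoc.IH[OF w] .
    then show ?case
      using affine_A_class_snoc[OF n w l] normal_form_step[OF l word_state_nondegenerate[OF n f a w l]]
      by simp
  qed
  moreover have zero: "word_state n w k = 0" if "k < n" for k
  proof -
    have "affine_vec n f (word_state n w k + int k) = affine_vec n f (int k)"
      using word_eval_affine_vec[OF n f w, of "int k"] that one by (simp add: affine_vec_def)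
    then show ?thesis using affine_vec_inj[OF _ f a] n by (auto dest: injD)
  qed
  \<comment> \<open>Descents at \<open>i < n\<close> inspect only indices below \<open>n\<close>, so
    vanishing there suffices.\<close>
  moreover have "normal_form (word_state n w) = \<one>\<^bsub>affine_A n\<^esub>"
    using zero by (intro normal_form_no_descent) (simp add: cyclic_descent_def)
  ultimately show ?thesis by simp
qed

theorem proposition4p5:
  fixes n :: nat and f :: "nat \<times> nat \<Rightarrow> complex" and a :: complex
  assumes "n \<ge> 3"
    and "legal_weight (cycle_darts n) f"
    and "(\<Prod>i<n. f (i, (i + 1) mod n)) = a"
    and "a \<noteq> 0"
    and "\<forall>k::nat. k > 0 \<longrightarrow> a ^ k \<noteq> 1"
  shows "weighted_rep n f \<in> mon (affine_A n) (GL n)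
    \<and> subgroup_generated (GL n) (omega n f ` {..<n}) \<cong> affine_A n"
proof -
  let ?h = "weighted_rep n f" and ?H = "subgroup_generated (GL n) (omega n f ` {..<n})"
  have a: "\<forall>k::nat. k > 0 \<longrightarrow> path_weight n f n ^ k \<noteq> 1"
    using assms(3,5) by (simp add: path_weight_def)
  have \<phi>: "omega n f \<in> {..<n} \<rightarrow> carrier (GL n)" by (auto intro: omega_GL)
  interpret A: group "affine_A n" unfolding affine_A_def by (rule group_presented_group)
  interpret GL: group "GL n" by (rule group_GL)
  interpret h: group_hom "affine_A n" "GL n" ?h
    by unfold_locales (rule weighted_rep_hom[OF assms(1,2)])
  have rep_class: "?h (affine_A_class n w) = word_eval (GL n) (omega n f) w" if "w \<in> words {..<n}" for w
    unfolding weighted_rep_def using omega_relators[OF assms(1,2)] that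
    by (intro group.presented_lift_class[OF group_GL \<phi>]) auto
  have "X = \<one>\<^bsub>affine_A n\<^esub>" if "X \<in> carrier (affine_A n)" "?h X = \<one>\<^bsub>GL n\<^esub>" for X
  proof -
    obtain w where "w \<in> words {..<n}" "X = affine_A_class n w"
      using \<open>X \<in> carrier (affine_A n)\<close> by (auto simp: affine_A_def carrier_presented_group)
    then show ?thesis
      using affine_A_class_trivial[OF assms(1,2) a] rep_class that(2) by (simp add: GL_simps)
  qed
  then have inj: "inj_on ?h (carrier (affine_A n))" by (simp add: h.inj_on_one_iff)
  \<comment> \<open>The isomorphism claim needs the image to be all of the matrix group:
    homomorphisms commute with \<open>generate\<close>, and the generators exhaust
    \<open>affine_A n\<close>.\<close>
  have "carrier ?H = generate (GL n) (omega n f ` {..<n})"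
    using \<phi> by (simp add: carrier_subgroup_generated Int_absorb1 image_subset_iff_funcset)
  also have "\<dots> = generate (GL n) (?h ` affine_A_gen n ` {..<n})"
    using weighted_rep_gen[OF assms(1,2)] by (simp add: image_image)
  also have "\<dots> = ?h ` generate (affine_A n) (affine_A_gen n ` {..<n})"
    by (rule h.generate_img) (auto intro: affine_A_gen_closed)
  finally have img: "carrier ?H = ?h ` carrier (affine_A n)"
    by (simp add: generate_affine_A[OF assms(1)])
  have "?h \<in> iso (affine_A n) ?H"
    using inj img by (intro isoI) (auto simp: hom_def bij_betw_def)
  then have "?H \<cong> affine_A n" using A.iso_sym is_isoI by blast
  then show ?thesis using inj h.homh by (simp add: mon_def)
qed

end
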